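(* Let $m\ge1$ be fixed and let $T$ be the completion time of the coupon collector problem with $n$ standard and $m$ reset coupon types. Put \[ C=\binom{n+m}{n},\qquad H=\sum_{j=m+1}^{n+m}\frac1j,\qquad s=\frac{n}{n+m},\qquad \alpha=\frac{s-mH}{C-1}. \] Then, as $n\to\infty$, \[ d_{\mathrm K}\!\left(\frac{T}{E[T]},\,\mathrm{Exp}(1)\right)\in\bigl[1-o(1),\,2+o(1)\bigr]\cdot|\alpha|, \] i.e. for every $\eta>0$ and all sufficiently large $n$, $(1-\eta)|\alpha|\le d_{\mathrm K}(T/E[T],\mathrm{Exp}(1))\le(2+\eta)|\alpha|$.
   Context: Coupon collector with reset: there are $n+m$ coupon types; types $1,\dots,n$ are standard and types $n+1,\dots,n+m$ are reset. At each step one type is drawn uniformly at random with replacement, independently. Standard draws accumulate; any draw of a reset type erases all coupons collected so far. $T$ is the number of steps until all $n$ standard types have been collected (i.e. have all been drawn since the last reset draw, or since the start if there was none). $\mathrm{Exp}(1)$ is the exponential distribution with mean $1$; $d_{\mathrm K}(X,Y)=\sup_x|P(X\le x)-P(Y\le x)|$ is the Kolmogorov distance. *)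

theory Defs
  imports "HOL-Probability.Probability"
begin

text \<open>Coupons are numbered \<open>1, \<dots>, n + m\<close>; those in \<open>{1..n}\<close> are standard, the others are reset
  coupons. A function \<open>d :: nat \<Rightarrow> nat\<close> is a sequence of draws, \<open>d t\<close> being the \<open>(t + 1)\<close>-st one,
  and \<open>collected n d t\<close> is the collection held after \<open>t\<close> draws.\<close>

primrec collected :: "nat \<Rightarrow> (nat \<Rightarrow> nat) \<Rightarrow> nat \<Rightarrow> nat set" where
  "collected n d 0 = {}"
| "collected n d (Suc t) = (if d t \<in> {1..n} then insert (d t) (collected n d t) else {})"

text \<open>On draw sequences that never complete the collection (an event of probability 0 for
  independent uniform draws) the infimum is over the empty set, and the value is 0.\<close>

definition completion_time :: "nat \<Rightarrow> (nat \<Rightarrow> nat) \<Rightarrow> nat" where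
  "completion_time n d = Inf {t. collected n d t = {1..n}}"

definition uniform_draws :: "'a measure \<Rightarrow> nat \<Rightarrow> (nat \<Rightarrow> 'a \<Rightarrow> nat) \<Rightarrow> bool" where
  "uniform_draws M k X \<longleftrightarrow>
     prob_space M \<and>
     prob_space.indep_vars M (\<lambda>_. count_space UNIV) X UNIV \<and>
     (\<forall>t. distr M (count_space UNIV) (X t) = measure_pmf (pmf_of_set {1..k}))"

text \<open>The Kolmogorov distance depends on the random variables only through their laws, so it is
  defined on probability measures.\<close>

definition kolmogorov_dist :: "real measure \<Rightarrow> real measure \<Rightarrow> real" where
  "kolmogorov_dist \<mu> \<nu> = (SUP x. \<bar>cdf \<mu> x - cdf \<nu> x\<bar>)"

definition exponential_measure :: "real \<Rightarrow> real measure" where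
  "exponential_measure l = density lborel (\<lambda>x. ennreal (exponential_density l x))"

end

theory Submission
  imports Defs "HOL-Real_Asymp.Real_Asymp"
begin

text \<open>Let \<open>f t = P(T > t)\<close> and let \<open>e t\<close> be the expected remaining time after \<open>t\<close> draws divided by
  \<open>\<mu> = E T = (C - 1) (n + m) / m\<close>, so that \<open>e (t + 1) = e t - f t / \<mu>\<close>. Since the empty collection is the
  worst state, \<open>g = f - e\<close> is nonnegative; comparison with the stationary law of the chain that is
  not stopped at completion gives \<open>g \<le> m H / (C - 1)\<close>. Solving the recursion for \<open>e\<close> places
  \<open>f t\<close> within \<open>m H / (C - 1)\<close> of \<open>(1 - 1 / \<mu>)\<^sup>t\<close>, which is the upper bound, as \<open>H\<close> tends to infinity
  and therefore \<open>\<bar>\<alpha>\<bar>\<close> is asymptotic to \<open>m H / (C - 1)\<close>.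

  The lower bound is attained just before the first time at which completion is likely at all, at
  \<open>t = (1 - \<epsilon>) (n + m) H\<close>: a Chernoff bound shows that \<open>P(T \<le> t)\<close> is \<open>o(1 / C)\<close>, whereas
  \<open>1 - exp (- t / \<mu>)\<close> is about \<open>(1 - \<epsilon>) m H / (C - 1)\<close>.\<close>

section \<open>The stopped chain of coupon counts\<close>

text \<open>The number of coupons held, stopped at completion, is a Markov chain on \<open>{0..n}\<close>;
  \<open>chain_step\<close> is its transition operator and \<open>chain_exp n m t \<phi>\<close> the expectation of \<open>\<phi>\<close> after \<open>t\<close> draws.\<close>

definition chain_step :: "nat \<Rightarrow> nat \<Rightarrow> (nat \<Rightarrow> real) \<Rightarrow> nat \<Rightarrow> real" where
  "chain_step n m \<phi> k =
     (if k = n then \<phi> n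
      else (real k * \<phi> k + (real n - real k) * \<phi> (Suc k) + real m * \<phi> 0) / real (n + m))"

definition chain_exp :: "nat \<Rightarrow> nat \<Rightarrow> nat \<Rightarrow> (nat \<Rightarrow> real) \<Rightarrow> real" where
  "chain_exp n m t \<phi> = (chain_step n m ^^ t) \<phi> 0"

lemma chain_exp_0 [simp]: "chain_exp n m 0 \<phi> = \<phi> 0"
  by (simp add: chain_exp_def)

text \<open>Splits off the last draw by transforming \<open>\<phi>\<close>, so that inductions over
  \<open>t\<close> keep the initial state 0 and generalize over \<open>\<phi>\<close>.\<close>

lemma chain_exp_Suc: "chain_exp n m (Suc t) \<phi> = chain_exp n m t (chain_step n m \<phi>)"
  by (simp add: chain_exp_def funpow_Suc_right del: funpow.simps)

lemma chain_step_mono: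
  assumes "\<And>k. k \<le> n \<Longrightarrow> \<phi> k \<le> \<psi> k" and "k \<le> n"
  shows "chain_step n m \<phi> k \<le> chain_step n m \<psi> k"
proof (cases "k = n")
  case False
  with assms show ?thesis
    unfolding chain_step_def
    by (auto intro!: divide_right_mono add_mono mult_left_mono)
qed (use assms in \<open>simp add: chain_step_def\<close>)

lemma chain_exp_mono:
  assumes "\<And>k. k \<le> n \<Longrightarrow> \<phi> k \<le> \<psi> k"
  shows "chain_exp n m t \<phi> \<le> chain_exp n m t \<psi>"
  using assms
proof (induction t arbitrary: \<phi> \<psi>)
  case (Suc t)
  show ?case
    unfolding chain_exp_Suc by (intro Suc.IH chain_step_mono Suc.prems)
qed auto

lemma chain_exp_cong:
  assumes "\<And>k. k \<le> n \<Longrightarrow> \<phi> k = \<psi> k"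
  shows "chain_exp n m t \<phi> = chain_exp n m t \<psi>"
  by (intro antisym chain_exp_mono) (simp_all add: assms)

lemma chain_step_add:
  "chain_step n m (\<lambda>k. \<phi> k + \<psi> k) = (\<lambda>k. chain_step n m \<phi> k + chain_step n m \<psi> k)"
  by (auto simp: chain_step_def fun_eq_iff distrib_left simp flip: add_divide_distrib)

lemma chain_step_cmult: "chain_step n m (\<lambda>k. c * \<phi> k) = (\<lambda>k. c * chain_step n m \<phi> k)"
  by (auto simp: chain_step_def fun_eq_iff algebra_simps add_divide_distrib)

lemma chain_exp_add:
  "chain_exp n m t (\<lambda>k. \<phi> k + \<psi> k) = chain_exp n m t \<phi> + chain_exp n m t \<psi>"
  by (induction t arbitrary: \<phi> \<psi>) (simp_all add: chain_exp_Suc chain_step_add)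

lemma chain_exp_cmult: "chain_exp n m t (\<lambda>k. c * \<phi> k) = c * chain_exp n m t \<phi>"
  by (induction t arbitrary: \<phi>) (simp_all add: chain_exp_Suc chain_step_cmult)

lemma chain_exp_diff:
  "chain_exp n m t (\<lambda>k. \<phi> k - \<psi> k) = chain_exp n m t \<phi> - chain_exp n m t \<psi>"
  using chain_exp_add[of n m t \<phi> "\<lambda>k. (- 1) * \<psi> k"] chain_exp_cmult[of n m t "- 1" \<psi>]
  by simp

lemma chain_step_const: "n + m > 0 \<Longrightarrow> chain_step n m (\<lambda>_. c) = (\<lambda>_. c)"
  by (auto simp: chain_step_def fun_eq_iff field_simps)

lemma chain_exp_const: "n + m > 0 \<Longrightarrow> chain_exp n m t (\<lambda>_. c) = c"
  by (induction t) (simp_all add: chain_exp_Suc chain_step_const)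

lemma chain_exp_sum:
  assumes "finite I" and "n + m > 0"
  shows "chain_exp n m t (\<lambda>k. \<Sum>i\<in>I. \<phi> i k) = (\<Sum>i\<in>I. chain_exp n m t (\<phi> i))"
  using assms by (induction I rule: finite_induct) (simp_all add: chain_exp_add chain_exp_const)

section \<open>Success probability before a reset and relative remaining time\<close>

definition alive :: "nat \<Rightarrow> nat \<Rightarrow> real" where
  "alive n k = (if k = n then 0 else 1)"

text \<open>The probability of completing the collection before the next reset when \<open>n - k\<close> standard
  coupons are missing: all of them must precede the \<open>m\<close> reset coupons.\<close>

definition win :: "nat \<Rightarrow> nat \<Rightarrow> nat \<Rightarrow> real" where
  "win n m k = 1 / real ((n + m - k) choose m)"

lemma win_pos: "k \<le> n \<Longrightarrow> win n m k > 0"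
  by (simp add: win_def)

lemma win_top [simp]: "win n m n = 1"
  by (simp add: win_def)

lemma win_le_1: "k \<le> n \<Longrightarrow> win n m k \<le> 1"
  by (simp add: win_def Suc_le_eq)

text \<open>First-step analysis: of the \<open>n + m - k\<close> coupons not held,
  \<open>n - k\<close> advance the collection. For the binomial coefficients this is the absorption
  identity.\<close>

lemma win_rec:
  assumes "k < n"
  shows "real (n + m - k) * win n m k = (real n - real k) * win n m (Suc k)"
proof -
  have "(n - k) * ((n + m - k) choose m) = (n + m - k) * ((n + m - Suc k) choose m)"
    using binomial_absorb_comp[of "n + m - k" m] assms by simp
  then have "real (n - k) * real ((n + m - k) choose m)
      = real (n + m - k) * real ((n + m - Suc k) choose m)"
    by (metis of_nat_mult)
  moreover have "real ((n + m - k) choose m) > 0" "real ((n + m - Suc k) choose m) > 0"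
    using assms by simp_all
  ultimately show ?thesis
    using assms by (simp add: win_def field_simps of_nat_diff)
qed

lemma win_mono_Suc:
  assumes "k < n"
  shows "win n m k \<le> win n m (Suc k)"
  unfolding win_def using assms
  by (intro divide_left_mono) (auto intro!: binomial_right_mono mult_pos_pos)

text \<open>\<open>win\<close> is harmonic for the chain killed at a reset. Here a reset restarts
  from the empty collection instead, which adds the reset probability times
  \<open>win n m 0\<close>.\<close>

lemma chain_step_win:
  assumes "k < n"
  shows "chain_step n m (win n m) k = win n m k + real m / real (n + m) * win n m 0"
proof -
  have "real k * win n m k + (real n - real k) * win n m (Suc k) = real (n + m) * win n m k"
    using win_rec[OF assms, of m] assms by (simp add: of_nat_diff algebra_simps)
  then show ?thesis
    using assms by (simp add: chain_step_def add_divide_distrib)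
qed

definition mean_time :: "nat \<Rightarrow> nat \<Rightarrow> real" where
  "mean_time n m = real (n + m) * (real ((n + m) choose n) - 1) / real m"

text \<open>The mean completion time from state \<open>k\<close>, relative to the one from state \<open>0\<close>.\<close>

definition rel_time :: "nat \<Rightarrow> nat \<Rightarrow> nat \<Rightarrow> real" where
  "rel_time n m k = (1 - win n m k) / (1 - win n m 0)"

lemma win_0: "win n m 0 = 1 / real ((n + m) choose n)"
  by (simp add: win_def binomial_symmetric[of m "n + m"])

lemma choose_ge:
  assumes "m \<ge> 1"
  shows "real ((n + m) choose n) \<ge> real n + 1"
proof -
  have "Suc n choose n \<le> (n + m) choose n"
    using assms by (intro binomial_right_mono) auto
  then show ?thesis by simp
qed

lemma win_0_less_1: "m \<ge> 1 \<Longrightarrow> n \<ge> 1 \<Longrightarrow> win n m 0 < 1"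
  using choose_ge[of m n] by (simp add: win_0)

lemma win_odds:
  assumes "m \<ge> 1" "n \<ge> 1"
  shows "win n m 0 / (1 - win n m 0) = 1 / (real ((n + m) choose n) - 1)"
proof -
  define C where "C = real ((n + m) choose n)"
  have "C > 1" using choose_ge[OF assms(1), of n] assms by (simp add: C_def)
  then show ?thesis unfolding win_0 C_def[symmetric] by (simp add: field_simps)
qed

text \<open>Keeps \<open>1 - 1 / mean_time n m\<close> in [0, 1), as the geometric comparison
  requires.\<close>

lemma mean_time_ge_1:
  assumes "m \<ge> 1" "n \<ge> 1"
  shows "mean_time n m \<ge> 1"
proof -
  have "real m * 1 \<le> real (n + m) * (real ((n + m) choose n) - 1)"
    using choose_ge[OF assms(1), of n] assms by (intro mult_mono) auto
  then show ?thesis using assms by (simp add: mean_time_def field_simps)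
qed

lemma rel_time_0 [simp]: "m \<ge> 1 \<Longrightarrow> n \<ge> 1 \<Longrightarrow> rel_time n m 0 = 1"
  using win_0_less_1[of m n] by (simp add: rel_time_def)

lemma rel_time_nonneg: "m \<ge> 1 \<Longrightarrow> n \<ge> 1 \<Longrightarrow> k \<le> n \<Longrightarrow> rel_time n m k \<ge> 0"
  using win_0_less_1[of m n] win_le_1[of k n m] by (simp add: rel_time_def)

text \<open>A draw before completion uses up one unit of time, which is
  \<open>1 / mean_time n m\<close> on the relative scale. As \<open>rel_time\<close> is affine in
  \<open>win\<close>, this amounts to the restart term of \<open>chain_step_win\<close>.\<close>

lemma chain_step_rel_time:
  assumes "m \<ge> 1" "n \<ge> 1" "k \<le> n"
  shows "chain_step n m (rel_time n m) k = rel_time n m k - alive n k / mean_time n m"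
proof (cases "k = n")
  case True
  then show ?thesis by (simp add: chain_step_def alive_def)
next
  case False
  define d where "d = 1 - win n m 0"
  have d: "d > 0" using win_0_less_1[OF assms(1,2)] by (simp add: d_def)
  have "chain_step n m (rel_time n m) k
      = chain_step n m (\<lambda>k. 1 / d + (- 1 / d) * win n m k) k"
    by (simp add: rel_time_def[abs_def] d_def diff_divide_distrib)
  also have "\<dots> = 1 / d - chain_step n m (win n m) k / d"
    unfolding chain_step_add chain_step_cmult using chain_step_const[of n m "1 / d"] assms by simp
  also have "\<dots> = rel_time n m k - real m / real (n + m) * win n m 0 / d"
    using assms False
    by (simp add: chain_step_win rel_time_def d_def diff_divide_distrib add_divide_distrib)
  also have "real m / real (n + m) * win n m 0 / d = real m / real (n + m) * (win n m 0 / d)"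
    by simp
  also have "\<dots> = 1 / mean_time n m"
    unfolding d_def win_odds[OF assms(1,2)] by (simp add: mean_time_def)
  finally show ?thesis using False by (simp add: alive_def)
qed

lemma chain_exp_rel_time_Suc:
  assumes "m \<ge> 1" "n \<ge> 1"
  shows "chain_exp n m (Suc t) (rel_time n m)
    = chain_exp n m t (rel_time n m) - chain_exp n m t (alive n) / mean_time n m"
proof -
  have "chain_exp n m (Suc t) (rel_time n m)
      = chain_exp n m t (\<lambda>k. rel_time n m k - 1 / mean_time n m * alive n k)"
    unfolding chain_exp_Suc
    by (rule chain_exp_cong) (simp add: chain_step_rel_time[OF assms])
  then show ?thesis by (simp only: chain_exp_diff chain_exp_cmult) simp
qed

lemma chain_exp_alive_nonneg: "n \<ge> 1 \<Longrightarrow> chain_exp n m t (alive n) \<ge> 0"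
  using chain_exp_mono[of n "\<lambda>_. 0" "alive n" m t] by (simp add: alive_def chain_exp_const)

text \<open>The right-hand side is the stationary probability of holding at least \<open>k\<close> coupons for the
  chain that is not stopped at completion.\<close>

lemma chain_exp_tail_le:
  assumes "m \<ge> 1" "n \<ge> 1" "k \<le> n"
  shows "chain_exp n m t (\<lambda>j. if k \<le> j \<and> j < n then 1 else 0) \<le> win n m 0 / win n m k"
  using assms(3)
proof (induction t arbitrary: k)
  case 0
  then show ?case using win_pos[of 0 n m] win_pos[of k n m] by (auto simp: less_imp_le)
next
  case (Suc t)
  let ?A = "\<lambda>k j. if k \<le> j \<and> j < n then 1 else (0::real)"
  show ?case
  proof (cases k)
    case 0
    have "chain_exp n m (Suc t) (?A k) \<le> chain_exp n m (Suc t) (\<lambda>_. 1)"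
      by (rule chain_exp_mono) auto
    then show ?thesis
      using 0 assms win_pos[of 0 n m] by (simp add: chain_exp_const)
  next
    case (Suc i)
    define N where "N = real (n + m)"
    have N: "N > 0" and i: "i < n" using assms Suc Suc.prems by (auto simp: N_def)
    \<comment> \<open>From \<open>k\<close> or more coupons a non-reset draw has probability
      \<open>n / N\<close>, split as \<open>i / N + (n - i) / N\<close>; from exactly
      \<open>i\<close> coupons at most \<open>(n - i) / N\<close> leads to \<open>k\<close>. A reset
      contributes nothing because \<open>k > 0\<close>.\<close>
    have "chain_exp n m (Suc t) (?A k)
        \<le> chain_exp n m t (\<lambda>j. real i / N * ?A k j + (real n - real i) / N * ?A i j)"
      unfolding chain_exp_Suc
    proof (rule chain_exp_mono)
      fix j assume "j \<le> n"
      then show "chain_step n m (?A k) j \<le> real i / N * ?A k j + (real n - real i) / N * ?A i j"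
        using N i assms Suc
        by (auto simp: chain_step_def N_def simp flip: add_divide_distrib
            intro!: divide_right_mono)
    qed
    also have "\<dots> = real i / N * chain_exp n m t (?A k) + (real n - real i) / N * chain_exp n m t (?A i)"
      by (simp only: chain_exp_add chain_exp_cmult)
    also have "\<dots> \<le> real i / N * (win n m 0 / win n m k)
        + (real n - real i) / N * (win n m 0 / win n m i)"
      using i N Suc.prems Suc.IH[of k] Suc.IH[of i] by (intro add_mono mult_left_mono) auto
    \<comment> \<open>Stationarity: by \<open>win_rec\<close> the bound is a fixed point of this
      recursion.\<close>
    also have "\<dots> = win n m 0 / win n m k"
    proof -
      have "(real n - real i) * win n m k = (N - real i) * win n m i"
        using win_rec[OF i, of m] i Suc by (simp add: N_def of_nat_diff)
      moreover have "win n m k > 0" "win n m i > 0" using i Suc by (auto intro: win_pos)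
      ultimately have "(real n - real i) / win n m i = (N - real i) / win n m k"
        by (simp add: frac_eq_eq)
      then have "(real n - real i) / N * (win n m 0 / win n m i)
          = win n m 0 / N * ((N - real i) / win n m k)"
        by (metis (no_types, lifting) mult.commute times_divide_times_eq times_divide_eq_left)
      moreover have "real i / N * (x / y) + x / N * ((N - real i) / y) = x / y" for x y :: real
        using N by (cases "y = 0") (simp_all add: field_simps)
      ultimately show ?thesis by simp
    qed
    finally show ?thesis .
  qed
qed

section \<open>Comparison of the tail of the completion time with a geometric law\<close>

text \<open>The quantity \<open>m H / (C - 1)\<close>; it differs from \<open>- \<alpha>\<close> by
  \<open>s / (C - 1)\<close>.\<close>

definition excess :: "nat \<Rightarrow> nat \<Rightarrow> real" where
  "excess n m = real m * (\<Sum>j = m + 1..n + m. 1 / real j) / (real ((n + m) choose n) - 1)"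

text \<open>Summation by parts: for \<open>k < n\<close> the left side is
  \<open>(win n m k - win n m 0) / (1 - win n m 0)\<close>, a telescoping sum of nonnegative
  increments. The tail indicators make \<open>chain_exp_tail_le\<close> applicable.\<close>

lemma alive_minus_rel_time:
  assumes "k \<le> n" "n \<ge> 1" "m \<ge> 1"
  shows "alive n k - rel_time n m k
    = (\<Sum>i<n. (win n m (Suc i) - win n m i) / (1 - win n m 0) *
                 (if Suc i \<le> k \<and> k < n then 1 else 0))"
proof (cases "k = n")
  case True
  then show ?thesis by (simp add: alive_def rel_time_def)
next
  case False
  have "(\<Sum>i<n. (win n m (Suc i) - win n m i) / (1 - win n m 0) *
                 (if Suc i \<le> k \<and> k < n then 1 else 0))
      = (\<Sum>i<k. (win n m (Suc i) - win n m i) / (1 - win n m 0))"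
    using False assms(1) by (intro sum.mono_neutral_cong_right) auto
  also have "\<dots> = (win n m k - win n m 0) / (1 - win n m 0)"
    by (simp add: sum_divide_distrib[symmetric] sum_lessThan_telescope)
  finally show ?thesis
    using False win_0_less_1[OF assms(3,2)] by (simp add: alive_def rel_time_def field_simps)
qed

lemma rel_time_le_alive:
  assumes "k \<le> n" "n \<ge> 1" "m \<ge> 1"
  shows "rel_time n m k \<le> alive n k"
proof -
  have "0 \<le> alive n k - rel_time n m k"
    unfolding alive_minus_rel_time[OF assms]
    using win_mono_Suc win_0_less_1[OF assms(3,2)] by (intro sum_nonneg) auto
  then show ?thesis by simp
qed

text \<open>By \<open>win_rec\<close> the increment of \<open>win\<close> at \<open>i\<close>,
  relative to \<open>win n m (Suc i)\<close>, is \<open>m / (n + m - i)\<close>: the chance that the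
  first of the \<open>n + m - i\<close> coupons not held to appear is a reset coupon. These chances
  add up to \<open>m H\<close>.\<close>

lemma sum_win_increments:
  assumes "n \<ge> 1" "m \<ge> 1"
  shows "(\<Sum>i<n. (win n m (Suc i) - win n m i) / (1 - win n m 0) * (win n m 0 / win n m (Suc i)))
    = excess n m"
proof -
  define C where "C = real ((n + m) choose n)"
  have C: "C > 1" using choose_ge[OF assms(2), of n] assms by (simp add: C_def)
  have "(\<Sum>i<n. (win n m (Suc i) - win n m i) / (1 - win n m 0) * (win n m 0 / win n m (Suc i)))
      = (\<Sum>i<n. real m / (C - 1) * (1 / real (n + m - i)))"
  proof (rule sum.cong)
    fix i assume "i \<in> {..<n}"
    then have i: "i < n" by simp
    have "win n m (Suc i) > 0" using i by (auto intro: win_pos)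
    moreover have "win n m i = (real n - real i) * win n m (Suc i) / real (n + m - i)"
      using win_rec[OF i, of m] i by (simp add: field_simps)
    moreover have "real (n + m - i) = real n + real m - real i" using i by (simp add: of_nat_diff)
    moreover have "1 - (real n - real i) / (real n + real m - real i)
        = real m / (real n + real m - real i)"
      using i by (simp add: field_simps)
    ultimately have "(win n m (Suc i) - win n m i) / win n m (Suc i) = real m / real (n + m - i)"
      by (simp add: diff_divide_distrib)
    moreover have "win n m 0 / (1 - win n m 0) = 1 / (C - 1)"
      by (simp only: win_odds[OF assms(2,1)] C_def)
    ultimately show "(win n m (Suc i) - win n m i) / (1 - win n m 0) * (win n m 0 / win n m (Suc i))
        = real m / (C - 1) * (1 / real (n + m - i))"
      by (metis (no_types, lifting) mult.commute mult.right_neutral times_divide_times_eq)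
  qed simp
  also have "\<dots> = real m / (C - 1) * (\<Sum>i<n. 1 / real (n + m - i))"
    by (simp only: sum_distrib_left)
  also have "(\<Sum>i<n. 1 / real (n + m - i)) = (\<Sum>j = m + 1..n + m. 1 / real j)"
    by (rule sum.reindex_bij_witness[of _ "\<lambda>j. n + m - j" "\<lambda>i. n + m - i"]) auto
  finally show ?thesis by (simp add: excess_def C_def)
qed

text \<open>The upper end applies the tail bounds termwise, the increments of \<open>win\<close>
  being nonnegative; the lower end expresses that the empty collection is the worst state.\<close>

lemma chain_exp_alive_minus_rel_time:
  assumes "n \<ge> 1" "m \<ge> 1"
  shows "chain_exp n m t (alive n) - chain_exp n m t (rel_time n m) \<in> {0..excess n m}"
proof -
  let ?c = "\<lambda>i. (win n m (Suc i) - win n m i) / (1 - win n m 0)"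
  let ?A = "\<lambda>k j. if k \<le> j \<and> j < n then 1 else (0::real)"
  have "chain_exp n m t (alive n) - chain_exp n m t (rel_time n m)
      = chain_exp n m t (\<lambda>k. alive n k - rel_time n m k)"
    by (simp add: chain_exp_diff)
  also have "\<dots> = chain_exp n m t (\<lambda>k. \<Sum>i<n. ?c i * ?A (Suc i) k)"
    by (rule chain_exp_cong) (use alive_minus_rel_time assms in blast)
  also have "\<dots> = (\<Sum>i<n. ?c i * chain_exp n m t (?A (Suc i)))"
    using assms by (subst chain_exp_sum) (simp_all only: chain_exp_cmult, auto)
  also have "\<dots> \<le> (\<Sum>i<n. ?c i * (win n m 0 / win n m (Suc i)))"
    using chain_exp_tail_le[OF assms(2,1)] win_mono_Suc win_0_less_1[OF assms(2,1)]
    by (intro sum_mono mult_left_mono) auto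
  also have "\<dots> = excess n m" by (rule sum_win_increments[OF assms])
  finally have "chain_exp n m t (alive n) - chain_exp n m t (rel_time n m) \<le> excess n m" .
  moreover have "chain_exp n m t (rel_time n m) \<le> chain_exp n m t (alive n)"
    by (rule chain_exp_mono) (use rel_time_le_alive assms in blast)
  ultimately show ?thesis by simp
qed

text \<open>In terms of \<open>g = f - e\<close> the recursion is
  \<open>e (t + 1) = (1 - \<delta>) * e t - \<delta> * g t\<close>. Dropping \<open>g\<close> gives
  the upper bound. The lower bound replaces \<open>g\<close> by \<open>excess n m\<close>, for which
  \<open>(1 - \<delta>) ^ t - excess n m\<close> is an exact solution.\<close>

lemma chain_exp_rel_time_bounds:
  assumes "n \<ge> 1" "m \<ge> 1"
  defines "\<delta> \<equiv> 1 / mean_time n m"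
  shows "(1 - \<delta>) ^ t - excess n m \<le> chain_exp n m t (rel_time n m)"
    and "chain_exp n m t (rel_time n m) \<le> (1 - \<delta>) ^ t"
proof -
  define e where "e t = chain_exp n m t (rel_time n m)" for t
  define g where "g t = chain_exp n m t (alive n) - chain_exp n m t (rel_time n m)" for t
  have d: "0 \<le> \<delta>" "\<delta> \<le> 1"
    using mean_time_ge_1[OF assms(2,1)] by (auto simp: \<delta>_def)
  have g: "0 \<le> g t" "g t \<le> excess n m" for t
    using chain_exp_alive_minus_rel_time[OF assms(1,2), of t] by (auto simp: g_def)
  have rec: "e (Suc t) = (1 - \<delta>) * e t - \<delta> * g t" for t
    using chain_exp_rel_time_Suc[OF assms(2,1), of t]
    by (simp add: e_def g_def \<delta>_def algebra_simps)
  have e0: "e 0 = 1" using assms by (simp add: e_def)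
  have "e t \<le> (1 - \<delta>) ^ t"
  proof (induction t)
    case (Suc t)
    have "e (Suc t) \<le> (1 - \<delta>) * e t" using rec[of t] d g[of t] by simp
    also have "\<dots> \<le> (1 - \<delta>) * (1 - \<delta>) ^ t" using Suc d by (intro mult_left_mono) auto
    finally show ?case by simp
  qed (simp add: e0)
  then show "chain_exp n m t (rel_time n m) \<le> (1 - \<delta>) ^ t" by (simp add: e_def)
  have "(1 - \<delta>) ^ t - excess n m \<le> e t"
  proof (induction t)
    case 0
    show ?case using e0 g[of 0] by simp
  next
    case (Suc t)
    have "(1 - \<delta>) ^ Suc t - excess n m
        = (1 - \<delta>) * ((1 - \<delta>) ^ t - excess n m) - \<delta> * excess n m"
      by (simp add: algebra_simps)
    also have "\<dots> \<le> (1 - \<delta>) * e t - \<delta> * g t"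
      using Suc d g[of t] by (intro diff_mono mult_left_mono) auto
    finally show ?case by (simp add: rec)
  qed
  then show "(1 - \<delta>) ^ t - excess n m \<le> chain_exp n m t (rel_time n m)" by (simp add: e_def)
qed

text \<open>In \<open>f = e + g\<close>, the term \<open>e\<close> falls short of the power by at
  most \<open>excess n m\<close> and \<open>g\<close> adds at most \<open>excess n m\<close>. The
  deviations have opposite signs, so they do not accumulate.\<close>

lemma chain_exp_alive_bounds:
  assumes "n \<ge> 1" "m \<ge> 1"
  shows "\<bar>chain_exp n m t (alive n) - (1 - 1 / mean_time n m) ^ t\<bar> \<le> excess n m"
  using chain_exp_rel_time_bounds[OF assms, of t] chain_exp_alive_minus_rel_time[OF assms, of t]
  by (auto simp: abs_le_iff)

text \<open>The tail sum for the mean: partial sums telescope to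
  \<open>mean_time n m * (1 - e t)\<close> by \<open>chain_exp_rel_time_Suc\<close>, and
  \<open>e t\<close> is dominated by a geometric sequence.\<close>

lemma chain_exp_alive_sums:
  assumes "n \<ge> 1" "m \<ge> 1"
  shows "(\<lambda>t. chain_exp n m t (alive n)) sums mean_time n m"
proof -
  let ?e = "\<lambda>t. chain_exp n m t (rel_time n m)"
  have mu: "mean_time n m \<ge> 1" using mean_time_ge_1[OF assms(2,1)] .
  have "(\<lambda>t. (1 - 1 / mean_time n m) ^ t) \<longlonglongrightarrow> 0"
    using mu by (intro LIMSEQ_realpow_zero) auto
  moreover have "0 \<le> ?e t" for t
    using chain_exp_mono[of n "\<lambda>_. 0" "rel_time n m" m t] assms
    by (simp add: rel_time_nonneg chain_exp_const)
  ultimately have lim: "?e \<longlonglongrightarrow> 0"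
    using chain_exp_rel_time_bounds(2)[OF assms]
    by (intro tendsto_sandwich[of "\<lambda>_. 0" ?e _ "\<lambda>t. (1 - 1 / mean_time n m) ^ t"]) auto
  have "(\<Sum>u<t. chain_exp n m u (alive n)) = mean_time n m * (1 - ?e t)" for t
    using mu assms
    by (induction t) (simp_all add: chain_exp_rel_time_Suc right_diff_distrib)
  then show ?thesis
    unfolding sums_def using lim by (auto intro!: tendsto_eq_intros)
qed

text \<open>A Chernoff bound: with \<open>N = n + m\<close>, the weight \<open>win n (Suc m)\<close> is the analogue of \<open>win n m\<close> for
  draws discounted by \<open>N / (N + 1)\<close>, so apart from restarts its expectation grows by a factor of at
  most \<open>1 + 1 / N\<close> per draw.\<close>

lemma chain_exp_alive_ge:
  assumes "n \<ge> 1" "m \<ge> 1"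
  shows "chain_exp n m t (alive n)
    \<ge> 1 - exp (real t / real (n + m)) * (1 + real m * real t / real (n + m)) *
        (real (m + 1) / (real (n + m + 1) * real ((n + m) choose n)))"
proof -
  define N where "N = real (n + m)"
  define w where "w = win n (Suc m)"
  have N: "N > 0" using assms by (simp add: N_def)
  have w_pos: "w k > 0" if "k \<le> n" for k using that by (simp add: w_def win_pos)
  \<comment> \<open>A restart contributes \<open>m / N * w 0\<close>; the other draws give the
    factor \<open>(N + 1) / N\<close> by \<open>win_rec\<close> with \<open>m + 1\<close> reset
    coupons. At \<open>k = n\<close> the chain stands still.\<close>
  have step: "chain_step n m w k \<le> (1 + 1 / N) * w k + real m / N * w 0" if "k \<le> n" for k
  proof (cases "k = n")
    case True
    then show ?thesis
      using N w_pos[of n] w_pos[of 0] by (simp add: chain_step_def algebra_simps)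
  next
    case False
    then have "(N + 1 - real k) * w k = (real n - real k) * w (Suc k)"
      using win_rec[of k n "Suc m"] that by (simp add: w_def N_def of_nat_diff add_ac)
    then have "chain_step n m w k = ((N + 1) * w k + real m * w 0) / N"
      using False by (simp add: chain_step_def N_def algebra_simps)
    then show ?thesis using N by (simp add: field_simps)
  qed
  have "chain_exp n m t w \<le> (1 + 1 / N) ^ t * (1 + real m * real t / N) * w 0"
  proof (induction t)
    case (Suc t)
    have "chain_exp n m (Suc t) w
        \<le> chain_exp n m t (\<lambda>k. (1 + 1 / N) * w k + real m / N * w 0)"
      unfolding chain_exp_Suc by (rule chain_exp_mono) (rule step)
    also have "\<dots> = (1 + 1 / N) * chain_exp n m t w + real m / N * w 0"
      using assms by (simp add: chain_exp_add chain_exp_cmult chain_exp_const)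
    \<comment> \<open>The restart term is enlarged by a power of \<open>1 + 1 / N\<close> so that it
      merges with the inductive bound.\<close>
    also have "\<dots> \<le> (1 + 1 / N) * ((1 + 1 / N) ^ t * (1 + real m * real t / N) * w 0)
        + (1 + 1 / N) ^ Suc t * (real m / N * w 0)"
    proof (intro add_mono mult_left_mono Suc)
      have "1 * (real m / N * w 0) \<le> (1 + 1 / N) ^ Suc t * (real m / N * w 0)"
        using N w_pos[of 0] by (intro mult_right_mono one_le_power) auto
      then show "real m / N * w 0 \<le> (1 + 1 / N) ^ Suc t * (real m / N * w 0)" by simp
    qed (use N in auto)
    also have "\<dots> = (1 + 1 / N) ^ Suc t * (1 + real m * real (Suc t) / N) * w 0"
      by (simp add: algebra_simps add_divide_distrib)
    finally show ?case .
  qed simp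
  also have "\<dots> \<le> exp (real t / N) * (1 + real m * real t / N) * w 0"
  proof (intro mult_right_mono)
    have "(1 + 1 / N) ^ t \<le> exp (1 / N) ^ t"
      using N by (intro power_mono exp_ge_add_one_self) auto
    then show "(1 + 1 / N) ^ t \<le> exp (real t / N)" by (simp flip: exp_of_nat_mult)
  qed (use N w_pos[of 0] in auto)
  \<comment> \<open>The additional reset coupon makes \<open>w 0\<close> smaller than
    \<open>1 / C\<close> by the factor \<open>(m + 1) / (N + 1)\<close>; this outweighs
    \<open>exp (t / N)\<close> for large \<open>N\<close> when \<open>t\<close> is at most
    \<open>(1 - \<epsilon>) * N * ln N\<close>.\<close>
  also have "w 0 = real (m + 1) / (N + 1) / real ((n + m) choose n)"
  proof -
    have "Suc m * (Suc (n + m) choose Suc m) = Suc (n + m) * ((n + m) choose n)"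
      using Suc_times_binomial_eq[of "n + m" m] binomial_symmetric[of m "n + m"]
      by (simp add: mult.commute)
    then have "real (Suc m) * real (Suc (n + m) choose Suc m) = (N + 1) * real ((n + m) choose n)"
      unfolding N_def by (metis of_nat_mult of_nat_Suc add.commute)
    moreover have "real ((n + m) choose n) > 0" "real (Suc (n + m) choose Suc m) > 0"
      by (simp_all del: binomial_Suc_Suc)
    moreover have "1 / d = a / b / c" if "a * d = b * c" "b > 0" "c > 0" "d > 0"
      for a b c d :: real
      using that by (simp add: divide_simps)
    ultimately have "1 / real (Suc (n + m) choose Suc m)
        = real (Suc m) / (N + 1) / real ((n + m) choose n)"
      using N by (meson add_pos_pos zero_less_one)
    then show ?thesis by (simp only: w_def win_def) simp
  qed
  finally have "chain_exp n m t w \<le> exp (real t / N) * (1 + real m * real t / N) *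
      (real (m + 1) / (N + 1) / real ((n + m) choose n))" .
  moreover have "1 - chain_exp n m t w \<le> chain_exp n m t (alive n)"
  proof -
    \<comment> \<open>Markov's inequality: \<open>w\<close> is nonnegative and equals 1 at
      \<open>n\<close>.\<close>
    have "chain_exp n m t (\<lambda>k. 1 - w k) \<le> chain_exp n m t (alive n)"
      by (rule chain_exp_mono) (use w_pos in \<open>auto simp: alive_def w_def less_imp_le\<close>)
    then show ?thesis using assms by (simp add: chain_exp_diff chain_exp_const)
  qed
  ultimately show ?thesis by (simp add: N_def add.commute)
qed

section \<open>Elementary estimates for the exponential function\<close>

lemma exp_minus_le_quadratic:
  fixes x :: real
  assumes "x \<ge> 0"
  shows "exp (- x) \<le> 1 - x + x\<^sup>2"
proof -
  have "(1 - x + x\<^sup>2) * (1 + x) = 1 + x ^ 3"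
    by (simp add: algebra_simps power2_eq_square power3_eq_cube)
  then have "1 / (1 + x) \<le> 1 - x + x\<^sup>2" using assms by (simp add: divide_le_eq)
  moreover have "exp (- x) \<le> 1 / (1 + x)"
    using exp_ge_add_one_self[of x] assms
    by (simp add: exp_minus inverse_eq_divide divide_left_mono)
  ultimately show ?thesis by simp
qed

text \<open>The error stays below \<open>\<delta>\<close> uniformly in \<open>t\<close>: a step
  multiplies it by \<open>1 - \<delta>\<close> and adds at most \<open>\<delta>^2\<close>, and
  \<open>\<delta>\<close> is the fixed point of this rule.\<close>

lemma exp_minus_le_power:
  fixes \<delta> :: real
  assumes "0 \<le> \<delta>" "\<delta> \<le> 1"
  shows "exp (- (real t * \<delta>)) \<le> (1 - \<delta>) ^ t + \<delta>"
proof (induction t)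
  case (Suc t)
  define x where "x = exp (- (real t * \<delta>))"
  have x: "0 \<le> x" "x \<le> 1" using assms by (auto simp: x_def)
  have "exp (- \<delta>) \<le> 1 - \<delta> + \<delta>\<^sup>2"
    using assms by (intro exp_minus_le_quadratic)
  then have "x * exp (- \<delta>) \<le> x * (1 - \<delta> + \<delta>\<^sup>2)" using x by (intro mult_left_mono)
  moreover have "exp (- (real (Suc t) * \<delta>)) = x * exp (- \<delta>)"
    by (simp add: x_def algebra_simps flip: exp_add)
  moreover have "x * \<delta>\<^sup>2 \<le> 1 * \<delta>\<^sup>2" using x by (intro mult_right_mono) auto
  moreover have "(1 - \<delta>) * x \<le> (1 - \<delta>) * ((1 - \<delta>) ^ t + \<delta>)"
    using Suc assms by (intro mult_left_mono) (auto simp: x_def)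
  ultimately show ?case by (simp add: algebra_simps power2_eq_square)
qed (use assms in auto)

section \<open>From draws to the chain\<close>

text \<open>Unlike \<open>collected\<close>, this dynamics freezes at the full set, so that
  completion by time \<open>t\<close> can be read off from the state at time
  \<open>t\<close>.\<close>

definition draw_step :: "nat \<Rightarrow> nat set \<Rightarrow> nat \<Rightarrow> nat set" where
  "draw_step n A c = (if A = {1..n} then A else if c \<in> {1..n} then insert c A else {})"

primrec stopped :: "nat \<Rightarrow> (nat \<Rightarrow> nat) \<Rightarrow> nat \<Rightarrow> nat set" where
  "stopped n d 0 = {}"
| "stopped n d (Suc t) = draw_step n (stopped n d t) (d t)"

lemma stopped_subset: "stopped n d t \<subseteq> {1..n}"
  by (induction t) (auto simp: draw_step_def)

lemma stopped_cong: "(\<And>u. u < t \<Longrightarrow> d u = d' u) \<Longrightarrow> stopped n d t = stopped n d' t"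
  by (induction t) auto

lemma stopped_cases:
  assumes "n \<ge> 1"
  shows "stopped n d t = {1..n} \<and> (\<exists>u\<le>t. collected n d u = {1..n}) \<or>
    stopped n d t = collected n d t \<and> (\<forall>u\<le>t. collected n d u \<noteq> {1..n})"
    (is "?full t \<or> ?running t")
proof (induction t)
  case 0
  show ?case using assms by simp
next
  case (Suc t)
  have le_Suc: "(\<forall>u\<le>Suc t. P u) \<longleftrightarrow> (\<forall>u\<le>t. P u) \<and> P (Suc t)"
      "(\<exists>u\<le>Suc t. P u) \<longleftrightarrow> (\<exists>u\<le>t. P u) \<or> P (Suc t)" for P
    by (auto simp: le_Suc_eq)
  from Suc show ?case
  proof
    assume "?full t"
    then have "?full (Suc t)" unfolding le_Suc stopped.simps draw_step_def by simp
    then show ?thesis by (rule disjI1)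
  next
    assume running: "?running t"
    then have ne: "collected n d t \<noteq> {1..n}" by simp
    have "stopped n d (Suc t) = collected n d (Suc t)"
      unfolding stopped.simps collected.simps draw_step_def
      using running by (simp only: ne if_False)
    then show ?thesis unfolding le_Suc using running by metis
  qed
qed

lemma stopped_full_iff:
  "n \<ge> 1 \<Longrightarrow> stopped n d t = {1..n} \<longleftrightarrow> (\<exists>u\<le>t. collected n d u = {1..n})"
  using stopped_cases[of n d t] by blast

text \<open>The second hypothesis excludes sequences that never complete, on which
  \<open>completion_time\<close> is only a default value.\<close>

lemma completion_time_gt_iff:
  assumes "n \<ge> 1" "stopped n d u = {1..n}"
  shows "t < completion_time n d \<longleftrightarrow> stopped n d t \<noteq> {1..n}"
proof -
  let ?S = "{t. collected n d t = {1..n}}"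
  have "?S \<noteq> {}"
    using assms stopped_full_iff by blast
  then have "completion_time n d \<in> ?S"
    unfolding completion_time_def by (rule Inf_nat_def1)
  moreover have "completion_time n d \<le> u" if "u \<in> ?S" for u
    unfolding completion_time_def using that by (rule cInf_lower) simp
  ultimately have "completion_time n d \<le> t \<longleftrightarrow> (\<exists>u\<le>t. collected n d u = {1..n})"
    by (blast intro: order_trans)
  then show ?thesis using stopped_full_iff[OF assms(1)] by (simp add: not_le[symmetric])
qed

text \<open>Lumpability: the law of the next count depends on the held set only through its size.
  The draws split into held, missing and reset coupons.\<close>

lemma sum_draw_step:
  assumes "A \<subseteq> {1..n}" "n + m > 0"
  shows "(\<Sum>c = 1..n + m. \<phi> (card (draw_step n A c))) / real (n + m)
    = chain_step n m \<phi> (card A)"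
proof (cases "A = {1..n}")
  case True
  then show ?thesis using assms by (simp add: draw_step_def chain_step_def del: of_nat_add)
next
  case False
  have fin: "finite A" using assms finite_subset by blast
  have "A \<subset> {1..n}" using assms False by auto
  then have card: "card A < n" using psubset_card_mono[of "{1..n}" A] by simp
  have "sum F {1..n + m} = sum F ({1..n + m} - {1..n}) + sum F {1..n}" for F :: "nat \<Rightarrow> real"
    by (rule sum.subset_diff) auto
  moreover have "sum F {1..n} = sum F ({1..n} - A) + sum F A" for F :: "nat \<Rightarrow> real"
    using assms(1) by (rule sum.subset_diff) simp
  moreover have "{1..n + m} - {1..n} = {n + 1..n + m}" by auto
  ultimately have "(\<Sum>c = 1..n + m. \<phi> (card (draw_step n A c)))
      = (\<Sum>c\<in>A. \<phi> (card (draw_step n A c))) + (\<Sum>c\<in>{1..n} - A. \<phi> (card (draw_step n A c)))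
        + (\<Sum>c = n + 1..n + m. \<phi> (card (draw_step n A c)))"
    by simp
  also have "(\<Sum>c\<in>A. \<phi> (card (draw_step n A c))) = (\<Sum>c\<in>A. \<phi> (card A))"
    using assms False by (intro sum.cong) (auto simp: draw_step_def insert_absorb)
  also have "(\<Sum>c\<in>{1..n} - A. \<phi> (card (draw_step n A c)))
      = (\<Sum>c\<in>{1..n} - A. \<phi> (Suc (card A)))"
    using assms False fin by (intro sum.cong) (auto simp: draw_step_def)
  also have "(\<Sum>c = n + 1..n + m. \<phi> (card (draw_step n A c))) = (\<Sum>c = n + 1..n + m. \<phi> 0)"
    using False by (intro sum.cong) (auto simp: draw_step_def)
  finally show ?thesis
    using card card_Diff_subset[OF fin assms(1)]
    by (simp add: chain_step_def of_nat_diff algebra_simps)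
qed

text \<open>Stated for arbitrary \<open>Y\<close> and \<open>N\<close> because it is applied both to
  the draws \<open>X\<close> and to the coordinates of a finite product space.\<close>

lemma measurable_stopped:
  assumes "\<And>u. u < t \<Longrightarrow> Y u \<in> measurable N (count_space UNIV)"
  shows "(\<lambda>\<omega>. stopped n (\<lambda>u. Y u \<omega>) t) \<in> measurable N (count_space (Pow {1..n}))"
  using assms
proof (induction t)
  case (Suc t)
  have [measurable]: "Y t \<in> measurable N (count_space UNIV)" using Suc.prems by simp
  have "(\<lambda>\<omega>. draw_step n (stopped n (\<lambda>u. Y u \<omega>) t) (Y t \<omega>))
      \<in> measurable N (count_space (Pow {1..n}))"
  proof (rule measurable_compose_countable'[where I = "Pow {1..n}"
        and f = "\<lambda>A \<omega>. draw_step n A (Y t \<omega>)" and g = "\<lambda>\<omega>. stopped n (\<lambda>u. Y u \<omega>) t"])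
    fix A assume A: "A \<in> Pow {1..n}"
    have "draw_step n A \<in> measurable (count_space UNIV) (count_space (Pow {1..n}))"
      using A by (auto simp: draw_step_def)
    then show "(\<lambda>\<omega>. draw_step n A (Y t \<omega>)) \<in> measurable N (count_space (Pow {1..n}))"
      by (rule measurable_compose[rotated]) measurable
  qed (use Suc in \<open>auto intro: countable_finite\<close>)
  then show ?case by simp
qed simp

section \<open>The law of the completion time under independent uniform draws\<close>

locale reset_collector = prob_space M for M :: "'a measure" +
  fixes n m :: nat and X :: "nat \<Rightarrow> 'a \<Rightarrow> nat"
  assumes draws: "uniform_draws M (n + m) X" and n_ge_1: "n \<ge> 1" and m_ge_1: "m \<ge> 1"
begin

lemma measurable_X [measurable]: "X t \<in> measurable M (count_space UNIV)"
  using draws unfolding uniform_draws_def indep_vars_def by blast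

definition state :: "nat \<Rightarrow> 'a \<Rightarrow> nat set" where
  "state t \<omega> = stopped n (\<lambda>u. X u \<omega>) t"

lemma state_subset: "state t \<omega> \<subseteq> {1..n}"
  unfolding state_def by (rule stopped_subset)

lemma measurable_state [measurable]: "state t \<in> measurable M (count_space (Pow {1..n}))"
  unfolding state_def[abs_def] by (rule measurable_stopped) measurable

lemma measurable_state_real [measurable]:
  "(\<lambda>\<omega>. F (state t \<omega>) :: real) \<in> borel_measurable M"
  by (rule measurable_compose[OF measurable_state]) simp

lemma expectation_draw: "expectation (\<lambda>\<omega>. F (X t \<omega>)) = (\<Sum>c = 1..n + m. F c) / real (n + m)"
proof -
  have "expectation (\<lambda>\<omega>. F (X t \<omega>)) = (\<integral>c. F c \<partial>distr M (count_space UNIV) (X t))"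
    by (subst integral_distr) auto
  also have "\<dots> = (\<integral>c. F c \<partial>measure_pmf (pmf_of_set {1..n + m}))"
    using draws by (simp add: uniform_draws_def)
  also have "\<dots> = (\<Sum>c = 1..n + m. F c) / real (n + m)"
    using n_ge_1 by (subst integral_pmf_of_set) auto
  finally show ?thesis .
qed

text \<open>The state at time \<open>t\<close> is a function of the draws with index below
  \<open>t\<close>, a block disjoint from \<open>{t}\<close>.\<close>

lemma indep_state_draw: "indep_var borel (\<lambda>\<omega>. G (state t \<omega>) :: real) borel (\<lambda>\<omega>. F (X t \<omega>))"
proof -
  let ?G = "\<lambda>d. G (stopped n d t)" and ?M' = "\<lambda>_. count_space UNIV :: nat measure"
  have "?G \<in> borel_measurable (PiM {..<t} ?M')"
    by (rule measurable_compose[OF measurable_stopped[of t "\<lambda>u d. d u"]])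
      (auto intro!: measurable_component_singleton)
  moreover have "(\<lambda>d. F (d t)) \<in> borel_measurable (PiM {t} ?M')"
    by (rule measurable_compose[OF measurable_component_singleton]) auto
  moreover have "indep_var (PiM {..<t} ?M') (\<lambda>\<omega>. \<lambda>i\<in>{..<t}. X i \<omega>) (PiM {t} ?M') (\<lambda>\<omega>. \<lambda>i\<in>{t}. X i \<omega>)"
    using draws by (intro indep_var_restrict[where I = UNIV]) (auto simp: uniform_draws_def)
  ultimately have "indep_var borel (?G \<circ> (\<lambda>\<omega>. \<lambda>i\<in>{..<t}. X i \<omega>))
      borel ((\<lambda>d. F (d t)) \<circ> (\<lambda>\<omega>. \<lambda>i\<in>{t}. X i \<omega>))"
    by (intro indep_var_compose)
  moreover have "stopped n (\<lambda>i\<in>{..<t}. X i \<omega>) t = state t \<omega>" for \<omega>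
    unfolding state_def by (rule stopped_cong) simp
  ultimately show ?thesis by (simp add: comp_def)
qed

lemma integrable_draw: "integrable M (\<lambda>\<omega>. F (X t \<omega>) :: real)"
proof -
  have "integrable (measure_pmf (pmf_of_set {1..n + m})) F"
    using n_ge_1 by (intro integrable_measure_pmf_finite) simp
  then have "integrable (distr M (count_space UNIV) (X t)) F"
    using draws by (simp add: uniform_draws_def)
  then show ?thesis by (rule integrable_distr[rotated]) simp
qed

lemma integrable_state: "integrable M (\<lambda>\<omega>. F (state t \<omega>) :: real)"
proof (rule integrable_const_bound)
  show "AE \<omega> in M. norm (F (state t \<omega>)) \<le> Max ((\<lambda>A. \<bar>F A\<bar>) ` Pow {1..n})"
    using state_subset by (intro AE_I2) (auto intro!: Max_ge)
qed simp

lemma sum_indicator_mult_state: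
  "(\<Sum>A\<in>Pow {1..n}. indicator {A} (state t \<omega>) * F A) = (F (state t \<omega>) :: real)"
proof -
  have "(\<Sum>A\<in>Pow {1..n}. indicator {A} (state t \<omega>) * F A)
      = (\<Sum>A\<in>Pow {1..n}. if state t \<omega> = A then F A else 0)"
    by (intro sum.cong) (auto simp: indicator_def)
  also have "\<dots> = F (state t \<omega>)"
    using state_subset[of t \<omega>] by (subst sum.delta') auto
  finally show ?thesis .
qed

text \<open>The Markov property. Splitting over the finitely many current states turns the
  expectation into a sum of products, each of which factors by \<open>indep_state_draw\<close>;
  \<open>sum_draw_step\<close> averages over the draw.\<close>

lemma expectation_state_Suc:
  "expectation (\<lambda>\<omega>. \<phi> (card (state (Suc t) \<omega>)))
    = expectation (\<lambda>\<omega>. chain_step n m \<phi> (card (state t \<omega>)))"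
proof -
  let ?F = "\<lambda>A c. \<phi> (card (draw_step n A c))" and ?I = "\<lambda>A B. indicator {A} B :: real"
  have int: "integrable M (\<lambda>\<omega>. ?I A (state t \<omega>) * ?F A (X t \<omega>))" for A
    by (rule indep_var_integrable[OF indep_state_draw integrable_state integrable_draw])
  have state_Suc: "\<phi> (card (state (Suc t) \<omega>)) = (\<Sum>A\<in>Pow {1..n}. ?I A (state t \<omega>) * ?F A (X t \<omega>))" for \<omega>
    unfolding sum_indicator_mult_state by (simp add: state_def)
  have "expectation (\<lambda>\<omega>. \<phi> (card (state (Suc t) \<omega>)))
      = (\<Sum>A\<in>Pow {1..n}. expectation (\<lambda>\<omega>. ?I A (state t \<omega>) * ?F A (X t \<omega>)))"
    unfolding state_Suc using int by (rule Bochner_Integration.integral_sum)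
  also have "\<dots> = (\<Sum>A\<in>Pow {1..n}. expectation (\<lambda>\<omega>. ?I A (state t \<omega>) * chain_step n m \<phi> (card A)))"
  proof (rule sum.cong)
    fix A assume A: "A \<in> Pow {1..n}"
    have "expectation (\<lambda>\<omega>. ?I A (state t \<omega>) * ?F A (X t \<omega>))
        = expectation (\<lambda>\<omega>. ?I A (state t \<omega>)) * expectation (\<lambda>\<omega>. ?F A (X t \<omega>))"
      by (rule indep_var_lebesgue_integral[OF indep_state_draw integrable_state integrable_draw])
    also have "expectation (\<lambda>\<omega>. ?F A (X t \<omega>)) = chain_step n m \<phi> (card A)"
      unfolding expectation_draw[of "?F A"] using A n_ge_1 by (intro sum_draw_step) auto
    finally show "expectation (\<lambda>\<omega>. ?I A (state t \<omega>) * ?F A (X t \<omega>))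
        = expectation (\<lambda>\<omega>. ?I A (state t \<omega>) * chain_step n m \<phi> (card A))"
      by simp
  qed simp
  also have "\<dots> = expectation (\<lambda>\<omega>. \<Sum>A\<in>Pow {1..n}. ?I A (state t \<omega>) * chain_step n m \<phi> (card A))"
    by (rule Bochner_Integration.integral_sum[symmetric])
      (rule integrable_state[where F = "\<lambda>B. ?I A B * chain_step n m \<phi> (card A)" for A])
  also have "(\<lambda>\<omega>. \<Sum>A\<in>Pow {1..n}. ?I A (state t \<omega>) * chain_step n m \<phi> (card A))
      = (\<lambda>\<omega>. chain_step n m \<phi> (card (state t \<omega>)))"
    by (rule ext) (rule sum_indicator_mult_state)
  finally show ?thesis .
qed

lemma expectation_state: "expectation (\<lambda>\<omega>. \<phi> (card (state t \<omega>))) = chain_exp n m t \<phi>"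
proof (induction t arbitrary: \<phi>)
  case 0
  then show ?case by (simp add: state_def prob_space)
next
  case (Suc t)
  then show ?case by (simp only: expectation_state_Suc chain_exp_Suc)
qed

lemma prob_state_not_full: "prob {\<omega>\<in>space M. state t \<omega> \<noteq> {1..n}} = chain_exp n m t (alive n)"
proof -
  have "card (state t \<omega>) = n \<longleftrightarrow> state t \<omega> = {1..n}" for \<omega>
    using card_subset_eq[OF _ state_subset[of t \<omega>]] by auto
  then have "alive n (card (state t \<omega>)) = indicator {\<omega>\<in>space M. state t \<omega> \<noteq> {1..n}} \<omega>"
    if "\<omega> \<in> space M" for \<omega> using that by (simp add: alive_def)
  then have "expectation (\<lambda>\<omega>. alive n (card (state t \<omega>)))
      = expectation (indicator {\<omega>\<in>space M. state t \<omega> \<noteq> {1..n}})"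
    by (intro Bochner_Integration.integral_cong) auto
  then show ?thesis by (simp add: expectation_state)
qed

text \<open>Never completing implies being incomplete at each time \<open>t\<close>, and those
  probabilities tend to 0 because they are summable.\<close>

lemma AE_completes: "AE \<omega> in M. \<exists>t. state t \<omega> = {1..n}"
proof -
  let ?B = "{\<omega>\<in>space M. \<forall>t. state t \<omega> \<noteq> {1..n}}"
  have B: "?B \<in> events" by measurable
  have "prob ?B \<le> chain_exp n m t (alive n)" for t
    unfolding prob_state_not_full[symmetric] by (rule finite_measure_mono) auto
  moreover have "(\<lambda>t. chain_exp n m t (alive n)) \<longlonglongrightarrow> 0"
    using chain_exp_alive_sums[OF n_ge_1 m_ge_1] by (intro summable_LIMSEQ_zero) (rule sums_summable)
  ultimately have "prob ?B \<le> 0" by (intro LIMSEQ_le_const) auto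
  then have "prob ?B = 0" by (simp add: measure_le_0_iff)
  then have "AE \<omega> in M. \<omega> \<notin> ?B" using B prob_eq_0 by simp
  then show ?thesis using AE_space by eventually_elim auto
qed

definition finish :: "'a \<Rightarrow> nat" where
  "finish \<omega> = completion_time n (\<lambda>t. X t \<omega>)"

lemma AE_finish_gt_iff: "AE \<omega> in M. \<forall>t. t < finish \<omega> \<longleftrightarrow> state t \<omega> \<noteq> {1..n}"
  using AE_completes
proof eventually_elim
  case (elim \<omega>)
  then show ?case
    unfolding finish_def state_def using completion_time_gt_iff[OF n_ge_1] by blast
qed

text \<open>The equality with a \<open>LEAST\<close> over measurable events is shown pointwise; on
  sequences that never complete both sides are the same default value.\<close>

lemma measurable_finish [measurable]: "finish \<in> measurable M (count_space UNIV)"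
proof -
  have full: "state t \<omega> = {1..n} \<longleftrightarrow> (\<exists>u\<le>t. collected n (\<lambda>u. X u \<omega>) u = {1..n})" for t \<omega>
    unfolding state_def by (rule stopped_full_iff[OF n_ge_1])
  have "finish \<omega> = (LEAST t. state t \<omega> = {1..n})" for \<omega>
  proof (cases "\<exists>t. state t \<omega> = {1..n}")
    case True
    have gt: "t < finish \<omega> \<longleftrightarrow> state t \<omega> \<noteq> {1..n}" for t
      using True completion_time_gt_iff[OF n_ge_1] unfolding finish_def state_def by blast
    show ?thesis
      by (rule Least_equality[symmetric]) (use gt in \<open>auto simp: not_less[symmetric]\<close>)
  next
    case False
    then have "collected n (\<lambda>t. X t \<omega>) t \<noteq> {1..n}" for t using full by blast
    then show ?thesis using False by (simp add: finish_def completion_time_def Inf_nat_def)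
  qed
  moreover have "(\<lambda>\<omega>. LEAST t. state t \<omega> = {1..n}) \<in> measurable M (count_space UNIV)"
    by measurable
  ultimately show ?thesis by (simp add: fun_eq_iff cong: measurable_cong)
qed

lemma prob_finish_gt: "prob {\<omega>\<in>space M. t < finish \<omega>} = chain_exp n m t (alive n)"
  unfolding prob_state_not_full[symmetric]
  using AE_finish_gt_iff by (intro finite_measure_eq_AE) auto

text \<open>The mean of a natural-number variable is the sum of its tail probabilities, which
  \<open>chain_exp_alive_sums\<close> evaluates.\<close>

lemma expectation_finish: "expectation (\<lambda>\<omega>. real (finish \<omega>)) = mean_time n m"
proof -
  have sums: "(\<lambda>t. chain_exp n m t (alive n)) sums mean_time n m"
    by (rule chain_exp_alive_sums[OF n_ge_1 m_ge_1])
  have nonneg: "0 \<le> chain_exp n m t (alive n)" for t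
    by (rule chain_exp_alive_nonneg[OF n_ge_1])
  have "(\<integral>\<^sup>+\<omega>. ennreal (real (finish \<omega>)) \<partial>M) = (\<Sum>t. emeasure M {\<omega>\<in>space M. t < finish \<omega>})"
    using nn_integral_nat_function[OF measurable_finish] by (simp add: ennreal_of_nat_eq_real_of_nat)
  also have "\<dots> = (\<Sum>t. ennreal (chain_exp n m t (alive n)))"
    by (simp add: emeasure_eq_measure prob_finish_gt)
  also have "\<dots> = ennreal (mean_time n m)"
    using sums nonneg by (simp add: suminf_ennreal2 sums_iff)
  finally show ?thesis
    using mean_time_ge_1[OF m_ge_1 n_ge_1] by (intro integral_eq_nn_integral[THEN trans]) auto
qed

lemma cdf_scaled_finish:
  assumes "\<mu> > 0"
  shows "cdf (distr M borel (\<lambda>\<omega>. real (finish \<omega>) / \<mu>)) x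
    = (if x < 0 then 0 else 1 - chain_exp n m (nat \<lfloor>x * \<mu>\<rfloor>) (alive n))"
proof -
  have "cdf (distr M borel (\<lambda>\<omega>. real (finish \<omega>) / \<mu>)) x
      = prob ((\<lambda>\<omega>. real (finish \<omega>) / \<mu>) -` {..x} \<inter> space M)"
    unfolding cdf_def by (rule measure_distr) simp_all
  also have "(\<lambda>\<omega>. real (finish \<omega>) / \<mu>) -` {..x} \<inter> space M = {\<omega>\<in>space M. real (finish \<omega>) \<le> x * \<mu>}"
    using assms by (auto simp: field_simps)
  also have "prob \<dots> = (if x < 0 then 0 else 1 - chain_exp n m (nat \<lfloor>x * \<mu>\<rfloor>) (alive n))"
  proof (cases "x < 0")
    case True
    then have "x * \<mu> < 0" using assms by (simp add: mult_less_0_iff)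
    then have "\<not> real (finish \<omega>) \<le> x * \<mu>" for \<omega>
      using of_nat_0_le_iff[of "finish \<omega>", where 'a = real] by linarith
    then show ?thesis using True by simp
  next
    case False
    then have "real (finish \<omega>) \<le> x * \<mu> \<longleftrightarrow> \<not> nat \<lfloor>x * \<mu>\<rfloor> < finish \<omega>" for \<omega>
      using assms by (simp add: le_nat_floor not_less le_nat_iff le_floor_iff)
    then have "prob {\<omega>\<in>space M. real (finish \<omega>) \<le> x * \<mu>}
        = prob {\<omega>\<in>space M. \<not> nat \<lfloor>x * \<mu>\<rfloor> < finish \<omega>}"
      by simp
    also have "\<dots> = 1 - prob {\<omega>\<in>space M. nat \<lfloor>x * \<mu>\<rfloor> < finish \<omega>}"
      by (rule prob_neg) measurable
    finally show ?thesis using False by (simp add: prob_finish_gt)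
  qed
  finally show ?thesis .
qed

end

lemma cdf_exponential_measure: "cdf (exponential_measure 1) x = (if x < 0 then 0 else 1 - exp (- x))"
proof -
  interpret E: prob_space "exponential_measure 1"
    unfolding exponential_measure_def by (rule prob_space_exponential_density) simp
  have "distributed (exponential_measure 1) lborel (\<lambda>x. x) (exponential_density 1)"
    by (simp add: distributed_def exponential_measure_def distr_id2)
  note D = E.exponential_distributedD_le[OF this]
  have space: "space (exponential_measure 1) = UNIV" by (simp add: exponential_measure_def)
  show ?thesis
  proof (cases "x < 0")
    case True
    \<comment> \<open>\<open>D\<close> covers nonnegative arguments; negative ones follow by
      monotonicity, as the value at 0 is 0.\<close>
    have "cdf (exponential_measure 1) x \<le> cdf (exponential_measure 1) 0"
      unfolding cdf_def using True
      by (intro E.finite_measure_mono) (auto simp: exponential_measure_def)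
    moreover have "cdf (exponential_measure 1) 0 = 0"
      using D[of 0] by (simp add: cdf_def space atMost_def)
    ultimately show ?thesis using True by (simp add: cdf_def measure_le_0_iff)
  next
    case False
    then show ?thesis using D[of x] by (simp add: cdf_def space atMost_def)
  qed
qed

section \<open>The Kolmogorov distance\<close>

context reset_collector
begin

abbreviation scaled_law :: "real measure" where
  "scaled_law \<equiv> distr M borel (\<lambda>\<omega>. real (finish \<omega>) / mean_time n m)"

text \<open>\<open>excess\<close> comes from the chain. Rounding \<open>x\<close> to a multiple of
  \<open>\<delta> = 1 / \<mu>\<close> and replacing the power by an exponential cost only one
  \<open>\<delta>\<close> together: in each direction just one of these two errors counts.\<close>

lemma cdf_diff_le:
  "\<bar>cdf scaled_law x - cdf (exponential_measure 1) x\<bar> \<le> excess n m + 1 / mean_time n m"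
proof (cases "x < 0")
  case True
  then show ?thesis
    using mean_time_ge_1[OF m_ge_1 n_ge_1] chain_exp_alive_bounds[OF n_ge_1 m_ge_1, of 0]
    by (simp add: cdf_scaled_finish cdf_exponential_measure)
next
  case False
  define \<mu> where "\<mu> = mean_time n m"
  define t where "t = nat \<lfloor>x * \<mu>\<rfloor>"
  define \<delta> where "\<delta> = 1 / \<mu>"
  have mu: "\<mu> \<ge> 1" unfolding \<mu>_def by (rule mean_time_ge_1[OF m_ge_1 n_ge_1])
  have d: "0 \<le> \<delta>" "\<delta> \<le> 1" using mu by (auto simp: \<delta>_def)
  have "x * \<mu> \<ge> 0" using False mu by simp
  then have "real t \<le> x * \<mu>" "x * \<mu> \<le> real t + 1" unfolding t_def by linarith+
  then have t: "real t * \<delta> \<le> x" "x \<le> real t * \<delta> + \<delta>"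
    using mu by (auto simp: \<delta>_def field_simps)
  have "exp (- x) \<le> (1 - \<delta>) ^ t + \<delta>"
    using exp_minus_le_power[OF d, of t] t(1) by (smt (verit) exp_le_cancel_iff)
  moreover have "(1 - \<delta>) ^ t \<le> exp (- x) + \<delta>"
  proof -
    have "(1 - \<delta>) ^ t \<le> exp (- \<delta>) ^ t"
      using exp_ge_add_one_self[of "- \<delta>"] d by (intro power_mono) auto
    also have "\<dots> = exp (- (real t * \<delta>))" by (simp flip: exp_of_nat_mult)
    also have "\<dots> \<le> exp (- x) + \<delta>"
    proof -
      have "(1 - exp (- \<delta>)) * exp (- (real t * \<delta>)) \<le> \<delta> * 1"
        using exp_ge_add_one_self[of "- \<delta>"] d by (intro mult_mono) auto
      moreover have "exp (- (real t * \<delta>) - \<delta>) \<le> exp (- x)" using t(2) by simp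
      ultimately show ?thesis by (simp add: algebra_simps exp_diff exp_minus divide_inverse)
    qed
    finally show ?thesis .
  qed
  ultimately show ?thesis
    using False mu chain_exp_alive_bounds[OF n_ge_1 m_ge_1, of t]
    by (simp add: cdf_scaled_finish cdf_exponential_measure \<mu>_def[symmetric] t_def[symmetric]
        \<delta>_def[symmetric])
qed

lemma kolmogorov_dist_le:
  "kolmogorov_dist scaled_law (exponential_measure 1) \<le> excess n m + 1 / mean_time n m"
  unfolding kolmogorov_dist_def by (rule cSUP_least) (use cdf_diff_le in auto)

lemma cdf_diff_le_kolmogorov_dist:
  "\<bar>cdf scaled_law x - cdf (exponential_measure 1) x\<bar>
    \<le> kolmogorov_dist scaled_law (exponential_measure 1)"
  unfolding kolmogorov_dist_def by (rule cSUP_upper) (use cdf_diff_le in \<open>auto intro!: bdd_aboveI2\<close>)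

text \<open>Evaluates the difference at the lattice point \<open>t / mean_time n m\<close>, where
  the floor in \<open>cdf_scaled_finish\<close> is exact.\<close>

lemma kolmogorov_dist_ge:
  "chain_exp n m t (alive n) - exp (- (real t / mean_time n m))
    \<le> kolmogorov_dist scaled_law (exponential_measure 1)"
proof -
  have mu: "mean_time n m > 0" using mean_time_ge_1[OF m_ge_1 n_ge_1] by simp
  then have "\<not> real t / mean_time n m < 0" "real t / mean_time n m * mean_time n m = real t"
    by (simp_all add: not_less)
  then have "cdf scaled_law (real t / mean_time n m)
        - cdf (exponential_measure 1) (real t / mean_time n m)
      = exp (- (real t / mean_time n m)) - chain_exp n m t (alive n)"
    by (simp only: cdf_scaled_finish[OF mu] cdf_exponential_measure if_False floor_of_nat nat_int)
  then show ?thesis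
    using cdf_diff_le_kolmogorov_dist[of "real t / mean_time n m"] by linarith
qed

end

section \<open>The harmonic sum and the lower bound\<close>

text \<open>The sum is \<open>harm (n + m) - harm m\<close>; here \<open>harm m \<ge> 1\<close>,
  while \<open>harm k - ln k\<close> decreases from its value 1 at \<open>k = 1\<close>.\<close>

lemma sum_inverse_le_ln:
  assumes "m \<ge> 1"
  shows "(\<Sum>j = m + 1..n + m. 1 / real j) \<le> ln (real (n + m))"
proof -
  have "(\<Sum>j = m + 1..n + m. 1 / real j) + 1 \<le> (\<Sum>j = m + 1..n + m. 1 / real j) + (\<Sum>j = 1..m. 1 / real j)"
    using member_le_sum[of 1 "{1..m}" "\<lambda>j. 1 / real j"] assms by simp
  also have "\<dots> = harm (n + m)"
    unfolding harm_def using sum.ub_add_nat[of 1 m "\<lambda>j. 1 / real j" n]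
    by (simp add: inverse_eq_divide add_ac)
  also have "\<dots> \<le> ln (real (n + m)) + 1"
    using decseqD[OF decseq_harm_diff_ln, of 0 "n + m - 1"] assms
    by (simp add: harm_expand)
  finally show ?thesis by simp
qed

lemma filterlim_sum_inverse:
  "filterlim (\<lambda>n. \<Sum>j = m + 1..n + m. 1 / real j) at_top sequentially"
proof -
  have "(\<Sum>j = m + 1..n + m. 1 / real j) = harm (n + m) - harm m" for n
    unfolding harm_def using sum.ub_add_nat[of 1 m "\<lambda>j. 1 / real j" n]
    by (simp add: inverse_eq_divide add_ac)
  moreover have "filterlim (\<lambda>n. - harm m + harm (n + m) :: real) at_top sequentially"
    using filterlim_compose[OF harm_at_top filterlim_add_const_nat_at_top[of m]]
    by (intro filterlim_tendsto_add_at_top[OF tendsto_const])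
  ultimately show ?thesis by simp
qed

text \<open>The summands of \<open>err\<close> are, in order, the loss from rounding
  \<open>t\<close> to an integer, the quadratic remainder of \<open>exp (- x)\<close>, and the
  Chernoff bound for completion by time \<open>t\<close>.\<close>

lemma (in reset_collector) kolmogorov_dist_ge_excess:
  fixes \<epsilon> :: real
  defines "N \<equiv> real (n + m)" and "H \<equiv> \<Sum>j = m + 1..n + m. 1 / real j"
  defines "err \<equiv> real m / N + (real m * ln N)\<^sup>2 / real n +
      N powr (1 - \<epsilon>) * (1 + real m * ln N) * (real (m + 1) / (N + 1))"
  assumes "0 < \<epsilon>" "\<epsilon> < 1"
  shows "((1 - \<epsilon>) * (real m * H) - err) / (real ((n + m) choose n) - 1)
    \<le> kolmogorov_dist scaled_law (exponential_measure 1)"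
proof -
  define C where "C = real ((n + m) choose n)"
  define t where "t = nat \<lfloor>(1 - \<epsilon>) * N * H\<rfloor>"
  define x where "x = real t / mean_time n m"
  define K where "K = C - 1"
  have C: "C \<ge> real n + 1" unfolding C_def by (rule choose_ge[OF m_ge_1])
  then have K: "K \<ge> real n" "K > 0" "K \<le> C" using n_ge_1 by (auto simp: K_def)
  have N: "N > 0" "N \<ge> 1" using n_ge_1 by (auto simp: N_def)
  have H: "0 \<le> H" "H \<le> ln N"
    unfolding H_def N_def by (simp add: sum_nonneg, rule sum_inverse_le_ln[OF m_ge_1])
  have "(1 - \<epsilon>) * N * H \<ge> 0" using assms H N by simp
  then have t: "real t \<le> (1 - \<epsilon>) * N * H" "(1 - \<epsilon>) * N * H - 1 \<le> real t"
    unfolding t_def by linarith+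
  have tN: "real t / N \<le> (1 - \<epsilon>) * H" using t(1) N by (simp add: field_simps)
  have H': "(1 - \<epsilon>) * H \<le> ln N"
    using H assms mult_left_le_one_le[of H "1 - \<epsilon>"] by simp
  have x_eq: "x = real m * (real t / N) / K"
    by (simp add: x_def mean_time_def N_def K_def C_def)
  have x0: "x \<ge> 0" using x_eq N K by simp
  have x_upper: "x \<le> real m * ln N / K"
    unfolding x_eq using tN H' K by (intro divide_right_mono mult_left_mono) auto
  have "(1 - \<epsilon>) * H - 1 / N = ((1 - \<epsilon>) * N * H - 1) / N"
    using N by (simp add: diff_divide_distrib)
  also have "\<dots> \<le> real t / N" using t(2) N by (intro divide_right_mono) auto
  finally have "(1 - \<epsilon>) * H - 1 / N \<le> real t / N" .
  then have "real m * ((1 - \<epsilon>) * H - 1 / N) / K \<le> x"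
    unfolding x_eq using K by (intro divide_right_mono mult_left_mono) auto
  then have x_lower: "((1 - \<epsilon>) * (real m * H) - real m / N) / K \<le> x"
    by (simp add: algebra_simps)
  have "x\<^sup>2 \<le> (real m * ln N / K)\<^sup>2" using x0 x_upper by (intro power_mono)
  also have "\<dots> = (real m * ln N)\<^sup>2 / K / K" by (simp add: power2_eq_square)
  \<comment> \<open>One of the two factors \<open>1 / K\<close> is given up for
    \<open>1 / n\<close>, which suffices to make this term negligible after multiplication by
    \<open>K\<close>.\<close>
  also have "\<dots> \<le> (real m * ln N)\<^sup>2 / real n / K"
    using K n_ge_1 by (intro divide_right_mono divide_left_mono mult_pos_pos) auto
  finally have x_sq: "x\<^sup>2 \<le> (real m * ln N)\<^sup>2 / real n / K" .
  have "exp (real t / N) * (1 + real m * real t / N) * (real (m + 1) / ((N + 1) * C))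
      \<le> N powr (1 - \<epsilon>) * (1 + real m * ln N) * (real (m + 1) / ((N + 1) * K))"
  proof (intro mult_mono)
    have "real t / N \<le> (1 - \<epsilon>) * ln N"
      using tN H(2) assms by (smt (verit) mult_left_mono)
    then show "exp (real t / N) \<le> N powr (1 - \<epsilon>)" using N by (simp add: powr_def)
    show "1 + real m * real t / N \<le> 1 + real m * ln N"
      using tN H' by (simp flip: times_divide_eq_right add: mult_left_mono)
    show "real (m + 1) / ((N + 1) * C) \<le> real (m + 1) / ((N + 1) * K)"
      using K N by (intro divide_left_mono mult_left_mono mult_pos_pos) auto
  qed (use N K in auto)
  moreover have "1 - exp (real t / N) * (1 + real m * real t / N) * (real (m + 1) / ((N + 1) * C))
      \<le> chain_exp n m t (alive n)"
    using chain_exp_alive_ge[OF n_ge_1 m_ge_1, of t] by (simp add: N_def C_def add_ac)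
  ultimately have alive: "1 - N powr (1 - \<epsilon>) * (1 + real m * ln N) * (real (m + 1) / (N + 1)) / K
      \<le> chain_exp n m t (alive n)"
    by simp
  have "((1 - \<epsilon>) * (real m * H) - err) / K = ((1 - \<epsilon>) * (real m * H) - real m / N) / K
      - (real m * ln N)\<^sup>2 / real n / K
      - N powr (1 - \<epsilon>) * (1 + real m * ln N) * (real (m + 1) / (N + 1)) / K"
    unfolding err_def by (simp only: diff_divide_distrib add_divide_distrib diff_diff_eq add.assoc)
  also have "\<dots> \<le> chain_exp n m t (alive n) - exp (- x)"
    using alive x_lower x_sq exp_minus_le_quadratic[OF x0] by linarith
  also have "\<dots> \<le> kolmogorov_dist scaled_law (exponential_measure 1)"
    unfolding x_def by (rule kolmogorov_dist_ge)
  finally show ?thesis by (simp add: K_def C_def)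
qed

text \<open>The summands are of order \<open>1 / N\<close>, \<open>(ln N)^2 / N\<close> and
  \<open>N powr (- \<epsilon>) * ln N\<close>, where \<open>N = n + m\<close>.\<close>

lemma error_tendsto_0:
  fixes \<epsilon> :: real and m :: nat
  assumes "0 < \<epsilon>" "\<epsilon> < 1" "m \<ge> 1"
  shows "(\<lambda>n. real m / real (n + m) + (real m * ln (real (n + m)))\<^sup>2 / real n +
      real (n + m) powr (1 - \<epsilon>) * (1 + real m * ln (real (n + m))) *
        (real (m + 1) / (real (n + m) + 1))) \<longlonglongrightarrow> 0"
proof -
  define a where "a = real m"
  have a: "a > 0" using assms by (simp add: a_def)
  have "(\<lambda>n. a / (real n + a) + (a * ln (real n + a))\<^sup>2 / real n +
      (real n + a) powr (1 - \<epsilon>) * (1 + a * ln (real n + a)) * ((a + 1) / (real n + a + 1)))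
      \<longlonglongrightarrow> 0"
    using assms(1,2) a by real_asymp
  then show ?thesis by (simp add: a_def add_ac)
qed

theorem theorem6p4:
  fixes m :: nat
    and M :: "nat \<Rightarrow> 'a measure"
    and X :: "nat \<Rightarrow> nat \<Rightarrow> 'a \<Rightarrow> nat"
    and T :: "nat \<Rightarrow> 'a \<Rightarrow> real"
    and C H s \<alpha> :: "nat \<Rightarrow> real"
  assumes "m \<ge> 1"
    and "\<And>n. uniform_draws (M n) (n + m) (X n)"
    and "\<And>n \<omega>. T n \<omega> = real (completion_time n (\<lambda>t. X n t \<omega>))"
    and "\<And>n. C n = real ((n + m) choose n)"
    and "\<And>n. H n = (\<Sum>j = m + 1..n + m. 1 / real j)"
    and "\<And>n. s n = real n / real (n + m)"
    and "\<And>n. \<alpha> n = (s n - real m * H n) / (C n - 1)"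
  shows "\<forall>\<eta>::real. \<eta> > 0 \<longrightarrow> (\<forall>\<^sub>F n in sequentially.
    kolmogorov_dist
        (distr (M n) borel (\<lambda>\<omega>. T n \<omega> / prob_space.expectation (M n) (T n)))
        (exponential_measure 1)
      \<in> {(1 - \<eta>) * \<bar>\<alpha> n\<bar> .. (2 + \<eta>) * \<bar>\<alpha> n\<bar>})"
proof (intro allI impI)
  fix \<eta> :: real assume "\<eta> > 0"
  \<comment> \<open>Of the total loss \<open>2 * \<epsilon> \<le> \<eta>\<close>, one
    \<open>\<epsilon>\<close> comes from evaluating at time \<open>(1 - \<epsilon>) * N * H\<close>
    and the other absorbs \<open>err\<close>. The minimum with 1 handles large
    \<open>\<eta>\<close>.\<close>
  define \<epsilon> where "\<epsilon> = min \<eta> 1 / 2"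
  have eps: "0 < \<epsilon>" "\<epsilon> < 1" "\<epsilon> \<le> 1 / 2" "2 * \<epsilon> \<le> \<eta>"
    using \<open>\<eta> > 0\<close> by (auto simp: \<epsilon>_def)
  define err where "err n = real m / real (n + m) + (real m * ln (real (n + m)))\<^sup>2 / real n +
      real (n + m) powr (1 - \<epsilon>) * (1 + real m * ln (real (n + m))) *
        (real (m + 1) / (real (n + m) + 1))" for n
  have "err \<longlonglongrightarrow> 0"
    unfolding err_def[abs_def] using eps assms(1) by (intro error_tendsto_0)
  then have "\<forall>\<^sub>F n in sequentially. err n < 1"
    by (rule order_tendstoD) simp
  \<comment> \<open>The bound 3 yields \<open>h + 1 \<le> 2 * (h - 1)\<close> for the upper
    estimate; the bound \<open>1 / \<epsilon>\<close> yields
    \<open>\<epsilon> * h \<ge> 1 > err n\<close> for the lower one.\<close>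
  moreover have "\<forall>\<^sub>F n in sequentially. H n \<ge> max 3 (1 / \<epsilon>)"
    using filterlim_sum_inverse[of m] unfolding filterlim_at_top assms(5)[abs_def] by blast
  moreover have "\<forall>\<^sub>F n in sequentially. n \<ge> 1"
    by (rule eventually_ge_at_top)
  ultimately show "\<forall>\<^sub>F n in sequentially.
    kolmogorov_dist
        (distr (M n) borel (\<lambda>\<omega>. T n \<omega> / prob_space.expectation (M n) (T n)))
        (exponential_measure 1)
      \<in> {(1 - \<eta>) * \<bar>\<alpha> n\<bar> .. (2 + \<eta>) * \<bar>\<alpha> n\<bar>}"
  proof eventually_elim
    case (elim n)
    interpret prob_space "M n" using assms(2)[of n] by (simp add: uniform_draws_def)
    interpret reset_collector "M n" n m "X n"
      by unfold_locales (use assms(1,2) elim in auto)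
    have T: "T n = (\<lambda>\<omega>. real (finish \<omega>))" by (simp add: fun_eq_iff assms(3) finish_def)
    let ?D = "kolmogorov_dist scaled_law (exponential_measure 1)"
    define K where "K = C n - 1"
    define h where "h = real m * H n"
    have K: "K > 0" using choose_ge[OF assms(1), of n] elim by (simp add: K_def assms(4))
    have s: "0 \<le> s n" "s n \<le> 1" using elim by (auto simp: assms(6) divide_le_eq_1)
    have "1 * H n \<le> h"
      unfolding h_def using assms(1) elim by (intro mult_right_mono) auto
    then have h: "h \<ge> 3" "h \<ge> 1 / \<epsilon>" using elim by auto
    then have eh: "\<epsilon> * h \<ge> 1" using eps by (simp add: field_simps)
    have alpha: "\<bar>\<alpha> n\<bar> = (h - s n) / K"
      using h s K by (simp add: assms(7) h_def[symmetric] K_def[symmetric])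
    have "?D \<le> excess n m + 1 / mean_time n m" by (rule kolmogorov_dist_le)
    \<comment> \<open>\<open>1 / mean_time n m\<close> has the same denominator
      \<open>C n - 1\<close>, with numerator \<open>m / (n + m) \<le> 1\<close>.\<close>
    also have "\<dots> = (h + real m / real (n + m)) / K"
      by (simp add: excess_def mean_time_def h_def K_def assms(4,5) add_divide_distrib)
    also have "\<dots> \<le> (2 + \<eta>) * (h - s n) / K"
    proof (rule divide_right_mono)
      have "h + real m / real (n + m) \<le> h + 1" using elim by (simp add: divide_le_eq_1)
      also have "\<dots> \<le> 2 * (h - s n)" using h(1) s by simp
      also have "\<dots> \<le> (2 + \<eta>) * (h - s n)"
        using \<open>\<eta> > 0\<close> h(1) s by (intro mult_right_mono) auto
      finally show "h + real m / real (n + m) \<le> (2 + \<eta>) * (h - s n)" .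
    qed (use K in simp)
    finally have "?D \<le> (2 + \<eta>) * \<bar>\<alpha> n\<bar>" by (simp add: alpha)
    moreover have "(1 - \<eta>) * \<bar>\<alpha> n\<bar> \<le> ?D"
    proof -
      have "(1 - \<eta>) * (h - s n) \<le> (1 - 2 * \<epsilon>) * (h - s n)"
        using eps h s by (intro mult_right_mono) auto
      also have "\<dots> \<le> (1 - 2 * \<epsilon>) * h" using eps s by (intro mult_left_mono) auto
      also have "\<dots> \<le> (1 - \<epsilon>) * h - err n"
        using eh elim by (simp add: algebra_simps)
      finally have "(1 - \<eta>) * (h - s n) / K \<le> ((1 - \<epsilon>) * h - err n) / K"
        using K by (intro divide_right_mono) auto
      also have "\<dots> \<le> ?D"
        using kolmogorov_dist_ge_excess[OF eps(1,2)]
        by (simp only: K_def h_def err_def assms(4,5))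
      finally show ?thesis by (simp add: alpha)
    qed
    ultimately show ?case by (simp add: T expectation_finish)
  qed
qed

end
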